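(* Let $q\ge1$ be an integer, let $\psi:\mathbb Z\to\mathbb C$ be periodic with period $q$, let $\omega=e^{2\pi i/q}$, let $\eta_\ell:=\exp\left(\frac i2\operatorname{Arg}(\omega^\ell)\right)$ for $0\le\ell<q$, and define $$\widehat\psi(\ell):=\frac1q\sum_{r=0}^{q-1}\psi(r)\omega^{-r\ell},\qquad 0\le\ell<q.$$ Then, for every integer $m\ge0$, $$\sum_{n\ge0}\psi(n)\frac{\binom{2n}{n}}{4^n(2n+1)}t_n(\{2\}^m)=\sum_{\ell=0}^{q-1}\widehat\psi(\ell)\frac{(\arcsin\eta_\ell)^{2m+1}}{(2m+1)!\,\eta_\ell}.$$ For every integer $m\ge1$, $$\sum_{n\ge1}\psi(n)\frac{4^n}{n^2\binom{2n}{n}}\zeta_{n-1}(\{2\}^{m-1})=\sum_{\ell=0}^{q-1}\widehat\psi(\ell)\frac{2^{2m}(\arcsin\eta_\ell)^{2m}}{(2m)!}.$$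
   Context: The principal argument satisfies $-\pi<\operatorname{Arg}w\le\pi$; $\arcsin$ is the principal inverse sine $\arcsin w=-i\operatorname{Log}(iw+\sqrt{1-w^2})$ with principal logarithm and principal square root (so $\sqrt{-1}=i$). For integers $n\ge0$, $m\ge0$, the finite repeated-$2$ sums are $$\zeta_n(\{2\}^m):=\sum_{n\ge n_1>\cdots>n_m\ge1}\frac1{n_1^2\cdots n_m^2},\qquad t_n(\{2\}^m):=\sum_{n\ge n_1>\cdots>n_m\ge1}\frac1{(2n_1-1)^2\cdots(2n_m-1)^2},$$ with the value $1$ when $m=0$ and the value $0$ when $m>n$. *)

theory Defs
  imports "HOL-Analysis.Analysis"
begin

text \<open>The index tuples \<open>n \<ge> n\<^sub>1 > \<dots> > n\<^sub>m \<ge> 1\<close>, as strictly decreasing lists of length \<open>m\<close>.\<close>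

definition decr_tuples :: "nat \<Rightarrow> nat \<Rightarrow> nat list set" where
  "decr_tuples n m = {ns. length ns = m \<and> sorted_wrt (>) ns \<and> set ns \<subseteq> {1..n}}"

definition zeta2 :: "nat \<Rightarrow> nat \<Rightarrow> real" where
  "zeta2 n m = (\<Sum>ns\<in>decr_tuples n m. \<Prod>j<m. 1 / (real (ns ! j))\<^sup>2)"

definition t2 :: "nat \<Rightarrow> nat \<Rightarrow> real" where
  "t2 n m = (\<Sum>ns\<in>decr_tuples n m. \<Prod>j<m. 1 / (2 * real (ns ! j) - 1)\<^sup>2)"

lemma finite_decr_tuples: "finite (decr_tuples n m)"
proof (rule finite_subset)
  show "decr_tuples n m \<subseteq> {ns. set ns \<subseteq> {1..n} \<and> length ns = m}"
    by (auto simp: decr_tuples_def)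
qed (simp add: finite_lists_length_eq)

lemma decr_tuples_0: "decr_tuples n 0 = {[]}"
  by (auto simp: decr_tuples_def)

lemma decr_tuples_empty:
  assumes "n < m"
  shows "decr_tuples n m = {}"
proof -
  have False if ns: "length ns = m" "sorted_wrt (>) ns" "set ns \<subseteq> {1..n}" for ns :: "nat list"
  proof -
    have "sorted_wrt (<) (rev ns)"
      using ns(2) by (simp add: sorted_wrt_rev)
    then have "distinct ns"
      by (simp add: strict_sorted_iff)
    then have "card (set ns) = m"
      using ns(1) distinct_card by fastforce
    moreover have "card (set ns) \<le> n"
      using card_mono[OF _ ns(3)] by simp
    ultimately show False
      using assms by simp
  qed
  then show ?thesis
    by (auto simp: decr_tuples_def)
qed

lemma zeta2_0: "zeta2 n 0 = 1" and t2_0: "t2 n 0 = 1"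
  by (simp_all add: zeta2_def t2_def decr_tuples_0)

lemma zeta2_eq_0: "n < m \<Longrightarrow> zeta2 n m = 0" and t2_eq_0: "n < m \<Longrightarrow> t2 n m = 0"
  by (simp_all add: zeta2_def t2_def decr_tuples_empty)

definition root_unity :: "nat \<Rightarrow> complex" where
  "root_unity q = exp (2 * of_real pi * \<i> / of_nat q)"

definition eta :: "nat \<Rightarrow> nat \<Rightarrow> complex" where
  "eta q l = exp (\<i> / 2 * of_real (Arg (root_unity q ^ l)))"

definition psi_hat :: "nat \<Rightarrow> (int \<Rightarrow> complex) \<Rightarrow> nat \<Rightarrow> complex" where
  "psi_hat q \<psi> l =
     1 / of_nat q * (\<Sum>r<q. \<psi> (int r) * root_unity q powi (- (int r * int l)))"

end

theory Submission
  imports Defs "HOL-Complex_Analysis.Complex_Analysis"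
begin

text \<open>
  With \<open>A = arcsin\<close>, the identity \<open>(1 - z\<^sup>2) A'\<^sup>2 = 1\<close> gives
  \<open>(1 - z\<^sup>2) F\<^sub>k'' = z F\<^sub>k' + F\<^sub>k\<^sub>-\<^sub>2\<close> for \<open>F\<^sub>k = A\<^sup>k / k!\<close>. The resulting
  recurrence for the Taylor coefficients is also satisfied by the central binomial terms
  weighted with \<open>t\<^sub>n\<close> and \<open>\<zeta>\<^sub>n\<^sub>-\<^sub>1\<close>, which identifies the two inside the unit disc. The
  coefficients are nonnegative and \<open>F\<^sub>k\<close> is bounded on \<open>[0,1)\<close>, so the series converge
  absolutely on the unit circle, and radial limits extend the expansions to \<open>\<eta>\<^sub>\<ell>\<close>, where
  \<open>Re \<eta>\<^sub>\<ell> \<ge> 0\<close> keeps the radius off the branch cuts. As \<open>\<eta>\<^sub>\<ell>\<^sup>2 = \<omega>\<^sup>\<ell>\<close>, finite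
  Fourier inversion finishes the proof.
\<close>

section \<open>Recursion of the repeated-2 sums in the upper bound\<close>

text \<open>A tuple either avoids \<open>Suc n\<close> or has it as its head, since the head is the
  largest entry.\<close>

lemma decr_tuples_Suc_Suc:
  "decr_tuples (Suc n) (Suc m) = decr_tuples n (Suc m) \<union> (#) (Suc n) ` decr_tuples n m"
proof (intro equalityI subsetI)
  fix xs assume xs: "xs \<in> decr_tuples (Suc n) (Suc m)"
  then obtain y ys where ys: "xs = y # ys"
    by (cases xs) (auto simp: decr_tuples_def)
  show "xs \<in> decr_tuples n (Suc m) \<union> (#) (Suc n) ` decr_tuples n m"
  proof (cases "y = Suc n")
    case True
    then have "ys \<in> decr_tuples n m"
      using xs ys by (fastforce simp: decr_tuples_def)
    then show ?thesis
      using True ys by auto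
  next
    case False
    then have "xs \<in> decr_tuples n (Suc m)"
      using xs ys by (fastforce simp: decr_tuples_def)
    then show ?thesis by simp
  qed
qed (fastforce simp: decr_tuples_def)+

text \<open>The weight \<open>w\<close> is kept general so that one splitting serves both
  \<open>zeta2\<close> and \<open>t2\<close>.\<close>

lemma sum_prod_decr_tuples_Suc:
  fixes w :: "nat \<Rightarrow> 'a::comm_semiring_1"
  shows "(\<Sum>ns\<in>decr_tuples (Suc n) (Suc m). \<Prod>j<Suc m. w (ns ! j)) =
    (\<Sum>ns\<in>decr_tuples n (Suc m). \<Prod>j<Suc m. w (ns ! j)) +
    w (Suc n) * (\<Sum>ns\<in>decr_tuples n m. \<Prod>j<m. w (ns ! j))"
proof -
  have disj: "decr_tuples n (Suc m) \<inter> (#) (Suc n) ` decr_tuples n m = {}"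
    by (fastforce simp: decr_tuples_def)
  have "(\<Sum>ns\<in>(#) (Suc n) ` decr_tuples n m. \<Prod>j<Suc m. w (ns ! j)) =
      (\<Sum>ns\<in>decr_tuples n m. w (Suc n) * (\<Prod>j<m. w (ns ! j)))"
    by (subst sum.reindex) (simp_all add: prod.lessThan_Suc_shift del: prod.lessThan_Suc)
  then show ?thesis
    unfolding decr_tuples_Suc_Suc
    by (subst sum.union_disjoint[OF _ _ disj])
      (auto simp: finite_decr_tuples sum_distrib_left)
qed

lemma zeta2_Suc_Suc: "zeta2 (Suc n) (Suc m) = zeta2 n (Suc m) + zeta2 n m / (real (Suc n))\<^sup>2"
  unfolding zeta2_def by (subst sum_prod_decr_tuples_Suc) simp

lemma t2_Suc_Suc: "t2 (Suc n) (Suc m) = t2 n (Suc m) + t2 n m / (2 * real n + 1)\<^sup>2"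
  unfolding t2_def by (subst sum_prod_decr_tuples_Suc) (simp add: algebra_simps)

lemma zeta2_nonneg: "0 \<le> zeta2 n m" and t2_nonneg: "0 \<le> t2 n m"
  by (auto simp: zeta2_def t2_def intro!: sum_nonneg prod_nonneg)

section \<open>Taylor coefficients of the powers of arcsin\<close>

abbreviation arcsin_fps :: "complex fps" where
  "arcsin_fps \<equiv> fps_expansion Arcsin 0"

text \<open>Dividing by \<open>fact k\<close> makes differentiation lower the index without a
  numerical factor.\<close>

definition arcsin_pow_fps :: "nat \<Rightarrow> complex fps" where
  "arcsin_pow_fps k = fps_const (1 / fact k) * arcsin_fps ^ k"

lemma holomorphic_on_Arcsin_ball: "Arcsin holomorphic_on ball 0 1"
  by (intro holomorphic_on_Arcsin) (use abs_Re_le_cmod in \<open>auto intro: le_less_trans\<close>)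

lemma has_fps_expansion_Arcsin: "Arcsin has_fps_expansion arcsin_fps"
  by (rule has_fps_expansion_fps_expansion[OF _ _ holomorphic_on_Arcsin_ball]) auto

lemma deriv_Arcsin:
  assumes "norm z < 1"
  shows "deriv Arcsin z = inverse (cos (Arcsin z))"
  using assms abs_Re_le_cmod[of z]
  by (intro DERIV_imp_deriv has_field_derivative_Arcsin) auto

lemma arcsin_fps_nth_0: "fps_nth arcsin_fps 0 = 0"
  by (simp add: fps_expansion_def)

lemma arcsin_fps_nth_1: "fps_nth arcsin_fps 1 = 1"
  by (simp add: fps_expansion_def deriv_Arcsin)

text \<open>The derivative is the inverse of \<open>cos (Arcsin z)\<close>, whose square is
  \<open>1 - z ^ 2\<close>. Squaring avoids any choice of a square root.\<close>

lemma arcsin_fps_deriv_square: "(1 - fps_X ^ 2) * fps_deriv arcsin_fps ^ 2 = 1"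
proof (rule fps_expansion_unique_complex)
  show "(\<lambda>z. (1 - z ^ 2) * deriv Arcsin z ^ 2) has_fps_expansion (1 - fps_X ^ 2) * fps_deriv arcsin_fps ^ 2"
    by (intro fps_expansion_intros has_fps_expansion_Arcsin)
  have "(1 - z ^ 2) * deriv Arcsin z ^ 2 = 1" if "z \<in> ball 0 1" for z :: complex
  proof -
    have "z\<^sup>2 \<noteq> 1"
      using that power_eq_1_iff by fastforce
    then have "cos (Arcsin z) \<noteq> 0"
      by (rule cos_Arcsin_nonzero)
    moreover have "cos (Arcsin z) ^ 2 = 1 - z ^ 2"
      by (simp add: cos_squared_eq)
    ultimately show ?thesis
      using that by (simp add: deriv_Arcsin field_simps)
  qed
  then have "eventually (\<lambda>z::complex. (1 - z ^ 2) * deriv Arcsin z ^ 2 = 1) (nhds 0)"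
    using eventually_nhds_in_open[of "ball (0::complex) 1" 0] by (auto elim!: eventually_mono)
  then show "(\<lambda>z. (1 - z ^ 2) * deriv Arcsin z ^ 2) has_fps_expansion 1"
    by (subst has_fps_expansion_cong[OF _ refl]) auto
qed

text \<open>Differentiate the squared identity and cancel twice the first derivative, which is
  nonzero in the integral domain of power series.\<close>

lemma arcsin_fps_ode: "(1 - fps_X ^ 2) * fps_deriv (fps_deriv arcsin_fps) = fps_X * fps_deriv arcsin_fps"
proof -
  let ?D = "fps_deriv arcsin_fps" and ?E = "fps_deriv (fps_deriv arcsin_fps)"
  have "fps_deriv ((1 - fps_X ^ 2) * ?D ^ 2) = 0"
    by (simp only: arcsin_fps_deriv_square fps_deriv_1)
  also have "fps_deriv ((1 - fps_X ^ 2) * ?D ^ 2) = 2 * ?D * ((1 - fps_X ^ 2) * ?E - fps_X * ?D)"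
    unfolding power2_eq_square fps_deriv_mult fps_deriv_sub fps_deriv_1 fps_deriv_fps_X
    by algebra
  finally have "2 * ?D * ((1 - fps_X ^ 2) * ?E - fps_X * ?D) = 0" .
  moreover have "?D \<noteq> 0"
    using arcsin_fps_deriv_square by (metis mult_zero_right zero_neq_one zero_power2)
  ultimately show ?thesis by simp
qed

lemma fps_deriv_arcsin_pow_fps_Suc:
  "fps_deriv (arcsin_pow_fps (Suc k)) = arcsin_pow_fps k * fps_deriv arcsin_fps"
proof -
  have "fps_const (1 / fact (Suc k)) * fps_const (of_nat (Suc k)) = fps_const (1 / fact k :: complex)"
    by (simp del: of_nat_Suc)
  moreover have "fps_deriv (arcsin_pow_fps (Suc k)) =
      (fps_const (1 / fact (Suc k)) * fps_const (of_nat (Suc k))) * arcsin_fps ^ k * fps_deriv arcsin_fps"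
    unfolding arcsin_pow_fps_def fps_deriv_mult fps_deriv_const fps_deriv_power
    by (simp only: diff_Suc_1 mult_zero_left add_0_right mult_ac)
  ultimately show ?thesis
    by (simp only: arcsin_pow_fps_def)
qed

text \<open>Writing A for arcsin, the second derivative of F_(k+2) is F_k A'^2 + F_(k+1) A''.
  Multiplication by 1 - X^2 turns A'^2 into 1 and A'' into X A'.\<close>

lemma arcsin_pow_fps_ode:
  "(1 - fps_X ^ 2) * fps_deriv (fps_deriv (arcsin_pow_fps (k + 2))) =
     fps_X * fps_deriv (arcsin_pow_fps (k + 2)) + arcsin_pow_fps k"
proof -
  let ?D = "fps_deriv arcsin_fps"
  have "(1 - fps_X ^ 2) * fps_deriv (fps_deriv (arcsin_pow_fps (k + 2))) =
     arcsin_pow_fps k * ((1 - fps_X ^ 2) * ?D ^ 2) +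
     arcsin_pow_fps (Suc k) * ((1 - fps_X ^ 2) * fps_deriv ?D)"
    by (simp add: fps_deriv_arcsin_pow_fps_Suc algebra_simps power2_eq_square)
  then show ?thesis
    unfolding arcsin_fps_deriv_square arcsin_fps_ode
    by (simp add: fps_deriv_arcsin_pow_fps_Suc mult_ac)
qed

lemma fps_nth_ode_rec:
  fixes F G :: "'a::comm_ring_1 fps"
  assumes "(1 - fps_X ^ 2) * fps_deriv (fps_deriv F) = fps_X * fps_deriv F + G"
  shows "of_nat ((n + 1) * (n + 2)) * fps_nth F (n + 2) = of_nat (n ^ 2) * fps_nth F n + fps_nth G n"
proof -
  let ?F' = "fps_deriv F" and ?F'' = "fps_deriv (fps_deriv F)"
  have "fps_nth ?F'' n = fps_nth (fps_X ^ 2 * ?F'') n + fps_nth (fps_X * ?F') n + fps_nth G n"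
    using arg_cong[OF assms, of "\<lambda>H. fps_nth H n"] by (simp add: algebra_simps)
  moreover have "fps_nth (fps_X ^ 2 * ?F'') n + fps_nth (fps_X * ?F') n = of_nat (n ^ 2) * fps_nth F n"
  proof -
    \<comment> \<open>The two products contribute n(n - 1) and n, hence n^2 together; for n below 2
      the shift by \<open>fps_X ^ 2\<close> gives 0, as the formula does.\<close>
    consider "n = 0" | "n = 1" | j where "n = j + 2"
      by (metis One_nat_def add_2_eq_Suc' not0_implies_Suc)
    then show ?thesis
      by cases (simp_all add: fps_X_power_mult_nth power2_eq_square algebra_simps)
  qed
  ultimately show ?thesis
    by (simp add: algebra_simps)
qed

lemma arcsin_pow_fps_0: "arcsin_pow_fps 0 = 1"
  by (simp add: arcsin_pow_fps_def)

lemma arcsin_pow_fps_1: "arcsin_pow_fps (Suc 0) = arcsin_fps"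
  by (simp add: arcsin_pow_fps_def)

lemma arcsin_pow_fps_nth_0: "k > 0 \<Longrightarrow> fps_nth (arcsin_pow_fps k) 0 = 0"
  by (simp add: arcsin_pow_fps_def arcsin_fps_nth_0 fps_power_zeroth)

text \<open>The derivative keeps a positive power of arcsin as a factor. The recurrence moves in
  steps of 2, so index 1 needs its own initial value.\<close>

lemma arcsin_pow_fps_Suc_Suc_nth_1: "fps_nth (arcsin_pow_fps (k + 2)) (Suc 0) = 0"
proof -
  have "fps_nth (fps_deriv (arcsin_pow_fps (Suc (Suc k)))) 0 = 0"
    unfolding fps_deriv_arcsin_pow_fps_Suc by (simp add: arcsin_pow_fps_nth_0)
  then show ?thesis by simp
qed

lemma arcsin_pow_fps_rec:
  "of_nat ((n + 1) * (n + 2)) * fps_nth (arcsin_pow_fps (k + 2)) (n + 2) =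
     of_nat (n ^ 2) * fps_nth (arcsin_pow_fps (k + 2)) n + fps_nth (arcsin_pow_fps k) n"
  by (rule fps_nth_ode_rec[OF arcsin_pow_fps_ode])

lemma arcsin_fps_rec:
  "of_nat ((n + 1) * (n + 2)) * fps_nth arcsin_fps (n + 2) = of_nat (n ^ 2) * fps_nth arcsin_fps n"
  using fps_nth_ode_rec[of arcsin_fps 0] arcsin_fps_ode by simp

text \<open>The recurrence shifts \<open>k\<close> and \<open>n\<close> by 2, so it preserves the
  parity of \<open>k + n\<close>; the initial values at \<open>n = 0\<close> and
  \<open>n = 1\<close> vanish when that sum is odd.\<close>

lemma arcsin_pow_fps_parity:
  assumes "odd (k + n)"
  shows "fps_nth (arcsin_pow_fps k) n = 0"
  using assms
proof (induction n arbitrary: k rule: induct_nat_012)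
  case 0
  then show ?case
    by (intro arcsin_pow_fps_nth_0) (auto intro: Nat.gr0I)
next
  case 1
  then consider "k = 0" | j where "k = j + 2"
    by (metis One_nat_def add_2_eq_Suc' even_add not0_implies_Suc odd_one)
  then show ?case
    using arcsin_pow_fps_Suc_Suc_nth_1 by cases (auto simp: arcsin_pow_fps_0)
next
  case (ge2 n)
  have "of_nat ((n + 1) * (n + 2)) * fps_nth (arcsin_pow_fps k) (n + 2) = 0"
  proof -
    consider "k = 0" | "k = 1" | j where "k = j + 2"
      by (metis One_nat_def add_2_eq_Suc' not0_implies_Suc)
    then show ?thesis
    proof cases
      case 2
      then show ?thesis
        using arcsin_fps_rec[of n] ge2 by (simp add: arcsin_pow_fps_1[symmetric])
    next
      case (3 j)
      then show ?thesis
        using arcsin_pow_fps_rec[of n j] ge2 by simp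
    qed (simp add: arcsin_pow_fps_0)
  qed
  then show ?case
    using of_nat_eq_0_iff[where ?'a = complex, of "(n + 1) * (n + 2)"] by (simp del: of_nat_mult of_nat_add)
qed

section \<open>Matching recurrences for the weighted central binomial terms\<close>

definition odd_coeff :: "nat \<Rightarrow> nat \<Rightarrow> real" where
  "odd_coeff m n = real ((2 * n) choose n) / (4 ^ n * (2 * real n + 1)) * t2 n m"

text \<open>Meaningful for positive \<open>m\<close> and \<open>n\<close>: natural subtraction
  truncates at 0, and division by zero makes the value at \<open>n = 0\<close> equal to 0.\<close>

definition even_coeff :: "nat \<Rightarrow> nat \<Rightarrow> real" where
  "even_coeff m n = 4 ^ n / ((real n)\<^sup>2 * real ((2 * n) choose n)) * zeta2 (n - 1) (m - 1)"

text \<open>Two absorption steps joined by the symmetry of the row 2n + 1 give the ratio of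
  consecutive central binomials, cleared of denominators.\<close>

lemma central_binomial_Suc:
  "real (Suc n) * real ((2 * Suc n) choose Suc n) = 2 * (2 * real n + 1) * real ((2 * n) choose n)"
proof -
  have "Suc n * (2 * Suc n choose Suc n) = Suc n * (2 * (Suc (2 * n) choose n))"
    using Suc_times_binomial[of n "Suc (2 * n)"] by (simp del: binomial_Suc_Suc)
  then have "(2 * Suc n choose Suc n) = 2 * (Suc (2 * n) choose n)"
    by (simp only: mult_cancel1) simp
  moreover have "Suc (2 * n) choose n = Suc (2 * n) choose Suc n"
    using binomial_symmetric[of n "Suc (2 * n)"] by (simp add: Suc_diff_le del: binomial_Suc_Suc)
  moreover have "Suc n * (Suc (2 * n) choose Suc n) = Suc (2 * n) * ((2 * n) choose n)"
    by (rule Suc_times_binomial)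
  ultimately have "Suc n * (2 * Suc n choose Suc n) = 2 * (Suc (2 * n) * ((2 * n) choose n))"
    by (metis mult.left_commute)
  then have "real (Suc n * (2 * Suc n choose Suc n)) = real (2 * (Suc (2 * n) * ((2 * n) choose n)))"
    by (rule arg_cong)
  then show ?thesis
    by (simp add: algebra_simps del: binomial_Suc_Suc)
qed

lemma odd_coeff_0: "odd_coeff m 0 = (if m = 0 then 1 else 0)"
  by (simp add: odd_coeff_def t2_0 t2_eq_0)

lemma odd_coeff_factor_Suc:
  "(2 * real n + 2) * (2 * real n + 3) * (real ((2 * Suc n) choose Suc n) / (4 ^ Suc n * (2 * real (Suc n) + 1))) =
   (2 * real n + 1)\<^sup>2 * (real ((2 * n) choose n) / (4 ^ n * (2 * real n + 1)))"
proof -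
  have "(2 * real n + 2) * (2 * real n + 3) * (real ((2 * Suc n) choose Suc n) / (4 ^ Suc n * (2 * real (Suc n) + 1))) =
      2 * (real (Suc n) * real ((2 * Suc n) choose Suc n)) / 4 ^ Suc n"
    by (simp add: divide_simps del: binomial_Suc_Suc) (simp add: algebra_simps del: binomial_Suc_Suc)
  also have "\<dots> = (2 * real n + 1) * real ((2 * n) choose n) / 4 ^ n"
    unfolding central_binomial_Suc by (simp add: field_simps)
  finally show ?thesis
    by (simp add: power2_eq_square del: binomial_Suc_Suc)
qed

text \<open>This is the Taylor recurrence at index 2n + 1: the factor
  \<open>(2 * real n + 1)\<^sup>2\<close> cancels the denominator of the term that \<open>t2\<close>
  gains.\<close>

lemma odd_coeff_rec:
  "(2 * real n + 2) * (2 * real n + 3) * odd_coeff m (Suc n) =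
    (2 * real n + 1)\<^sup>2 * odd_coeff m n + (if m = 0 then 0 else odd_coeff (m - 1) n)"
proof -
  let ?c = "\<lambda>n. real ((2 * n) choose n) / (4 ^ n * (2 * real n + 1))"
  have "(2 * real n + 2) * (2 * real n + 3) * odd_coeff m (Suc n) =
      (2 * real n + 1)\<^sup>2 * ?c n * t2 (Suc n) m"
    unfolding odd_coeff_def odd_coeff_factor_Suc[symmetric] by (simp only: mult.assoc)
  also have "\<dots> = ?c n * ((2 * real n + 1)\<^sup>2 * t2 (Suc n) m)"
    by (simp only: mult_ac)
  also have "(2 * real n + 1)\<^sup>2 * t2 (Suc n) m =
      (2 * real n + 1)\<^sup>2 * t2 n m + (if m = 0 then 0 else t2 n (m - 1))"
    by (cases m) (simp_all add: t2_0 t2_Suc_Suc distrib_left add_eq_0_iff)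
  finally show ?thesis
    unfolding odd_coeff_def by (simp add: distrib_left)
qed

text \<open>Outer induction on the power supplies the inhomogeneous term, inner induction on
  \<open>n\<close> the previous coefficient. The leading factor \<open>?K\<close> is nonzero and can
  be cancelled.\<close>

lemma arcsin_pow_fps_odd:
  "fps_nth (arcsin_pow_fps (2 * m + 1)) (2 * n + 1) = of_real (odd_coeff m n)"
proof (induction m arbitrary: n)
  case 0
  show ?case
  proof (induction n)
    case 0
    then show ?case
      using arcsin_fps_nth_1 by (simp add: arcsin_pow_fps_1 odd_coeff_0)
  next
    case (Suc n)
    let ?K = "complex_of_nat ((2 * n + 2) * (2 * n + 3))"
    have "?K * fps_nth arcsin_fps (2 * Suc n + 1) = of_nat ((2 * n + 1) ^ 2) * of_real (odd_coeff 0 n)"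
      using arcsin_fps_rec[of "2 * n + 1"] Suc.IH by (simp add: arcsin_pow_fps_1 eval_nat_numeral)
    also have "\<dots> = of_real ((2 * real n + 2) * (2 * real n + 3) * odd_coeff 0 (Suc n))"
      unfolding odd_coeff_rec by (simp add: add_ac)
    also have "\<dots> = ?K * of_real (odd_coeff 0 (Suc n))"
      by (simp add: algebra_simps)
    finally show ?case
      by (subst (asm) mult_left_cancel) (simp_all only: of_nat_eq_0_iff, simp_all add: arcsin_pow_fps_1)
  qed
next
  case (Suc m)
  note IH = Suc.IH
  show ?case
  proof (induction n)
    case 0
    then show ?case
      using arcsin_pow_fps_Suc_Suc_nth_1[of "2 * m + 1"] by (simp add: odd_coeff_0)
  next
    case (Suc n)
    let ?K = "complex_of_nat ((2 * n + 2) * (2 * n + 3))"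
    have "?K * fps_nth (arcsin_pow_fps (2 * Suc m + 1)) (2 * Suc n + 1) =
        of_nat ((2 * n + 1) ^ 2) * of_real (odd_coeff (Suc m) n) + of_real (odd_coeff m n)"
      using arcsin_pow_fps_rec[of "2 * n + 1" "2 * m + 1"] Suc.IH IH[of n] by (simp add: eval_nat_numeral)
    also have "\<dots> = of_real ((2 * real n + 2) * (2 * real n + 3) * odd_coeff (Suc m) (Suc n))"
      unfolding odd_coeff_rec by (simp add: add_ac)
    also have "\<dots> = ?K * of_real (odd_coeff (Suc m) (Suc n))"
      by (simp add: algebra_simps)
    finally show ?case
      by (subst (asm) mult_left_cancel) (simp_all only: of_nat_eq_0_iff, simp_all)
  qed
qed

text \<open>The central binomial ratio enters inverted here. Starting at \<open>N = Suc n\<close>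
  keeps the denominators nonzero.\<close>

lemma even_coeff_factor_Suc:
  fixes n :: nat
  defines "N \<equiv> Suc n"
  shows "(2 * real n + 3) * (2 * real n + 4) * (4 ^ Suc N / ((real (Suc N))\<^sup>2 * real ((2 * Suc N) choose Suc N))) =
   4 * (real N)\<^sup>2 * (4 ^ N / ((real N)\<^sup>2 * real ((2 * N) choose N)))"
proof -
  have pos: "real ((2 * N) choose N) > 0" "real ((2 * Suc N) choose Suc N) > 0"
    by (simp_all add: zero_less_binomial del: binomial_Suc_Suc)
  have *: "(real (Suc N))\<^sup>2 * real ((2 * Suc N) choose Suc N) =
     real (Suc N) * (2 * (2 * real N + 1) * real ((2 * N) choose N))"
    using central_binomial_Suc[of N] by (simp only: power2_eq_square mult.assoc)
  have "(2 * real n + 3) * (2 * real n + 4) = (2 * real N + 1) * (2 * real (Suc N))"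
    by (simp add: N_def algebra_simps)
  moreover have "real N > 0" by (simp add: N_def)
  ultimately show ?thesis
    unfolding * using pos(1) by (simp add: divide_simps del: binomial_Suc_Suc of_nat_Suc)
qed

lemma even_coeff_1: "even_coeff (Suc m) (Suc 0) = (if m = 0 then 2 else 0)"
  by (simp add: even_coeff_def zeta2_0 zeta2_eq_0)

text \<open>The Taylor recurrence at index 2n + 2, scaled by \<open>4 ^ Suc m\<close>; lowering the
  power by 2 leaves one factor 4 in front of the last term.\<close>

lemma even_coeff_rec:
  "(2 * real n + 3) * (2 * real n + 4) * even_coeff (Suc m) (Suc (Suc n)) =
    4 * (real (Suc n))\<^sup>2 * even_coeff (Suc m) (Suc n) + (if m = 0 then 0 else 4 * even_coeff m (Suc n))"
proof -
  let ?c = "\<lambda>n. 4 ^ n / ((real n)\<^sup>2 * real ((2 * n) choose n))"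
  have "(2 * real n + 3) * (2 * real n + 4) * even_coeff (Suc m) (Suc (Suc n)) =
      4 * (real (Suc n))\<^sup>2 * ?c (Suc n) * zeta2 (Suc n) m"
    unfolding even_coeff_def even_coeff_factor_Suc[symmetric] by (simp only: mult.assoc diff_Suc_1)
  also have "\<dots> = 4 * ?c (Suc n) * ((real (Suc n))\<^sup>2 * zeta2 (Suc n) m)"
    by (simp only: mult_ac)
  also have "(real (Suc n))\<^sup>2 * zeta2 (Suc n) m =
      (real (Suc n))\<^sup>2 * zeta2 n m + (if m = 0 then 0 else zeta2 n (m - 1))"
    by (cases m) (simp_all add: zeta2_0 zeta2_Suc_Suc distrib_left del: of_nat_Suc)
  finally show ?thesis
    unfolding even_coeff_def by (simp add: distrib_left del: of_nat_Suc binomial_Suc_Suc)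
qed

text \<open>The division by \<open>4 ^ Suc m\<close> accounts for the factor
  \<open>2 ^ (2 * Suc m)\<close> in the closed form. The start at index 2 comes from the recurrence
  at 0, where only the inhomogeneous term survives.\<close>

lemma arcsin_pow_fps_even:
  "fps_nth (arcsin_pow_fps (2 * Suc m)) (2 * Suc n) = of_real (even_coeff (Suc m) (Suc n) / 4 ^ Suc m)"
proof (induction m arbitrary: n)
  case 0
  show ?case
  proof (induction n)
    case 0
    then show ?case
      using arcsin_pow_fps_rec[of 0 0] by (simp add: arcsin_pow_fps_0 even_coeff_1 eval_nat_numeral field_simps)
  next
    case (Suc n)
    let ?K = "complex_of_nat ((2 * n + 3) * (2 * n + 4))"
    have "?K * fps_nth (arcsin_pow_fps (2 * Suc 0)) (2 * Suc (Suc n)) =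
        of_nat ((2 * Suc n) ^ 2) * of_real (even_coeff (Suc 0) (Suc n) / 4 ^ Suc 0)"
      using arcsin_pow_fps_rec[of "2 * Suc n" "0"] Suc.IH
      by (simp add: eval_nat_numeral arcsin_pow_fps_0)
    also have "\<dots> = of_real ((2 * real n + 3) * (2 * real n + 4) * even_coeff (Suc 0) (Suc (Suc n)) / 4 ^ Suc 0)"
      unfolding even_coeff_rec by (simp add: field_simps power2_eq_square)
    also have "\<dots> = ?K * of_real (even_coeff (Suc 0) (Suc (Suc n)) / 4 ^ Suc 0)"
      by simp
    finally show ?case
      by (subst (asm) mult_left_cancel) (simp_all only: of_nat_eq_0_iff, simp_all)
  qed
next
  case (Suc m)
  note IH = Suc.IH
  show ?case
  proof (induction n)
    case 0
    then show ?case
      using arcsin_pow_fps_rec[of 0 "2 * Suc m"]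
      by (simp add: arcsin_pow_fps_nth_0 even_coeff_1 eval_nat_numeral)
  next
    case (Suc n)
    let ?K = "complex_of_nat ((2 * n + 3) * (2 * n + 4))"
    have "?K * fps_nth (arcsin_pow_fps (2 * Suc (Suc m))) (2 * Suc (Suc n)) =
        of_nat ((2 * Suc n) ^ 2) * of_real (even_coeff (Suc (Suc m)) (Suc n) / 4 ^ Suc (Suc m)) +
        of_real (even_coeff (Suc m) (Suc n) / 4 ^ Suc m)"
      using arcsin_pow_fps_rec[of "2 * Suc n" "2 * Suc m"] Suc.IH IH[of n]
      by (simp add: eval_nat_numeral)
    also have "\<dots> = of_real ((2 * real n + 3) * (2 * real n + 4) * even_coeff (Suc (Suc m)) (Suc (Suc n)) / 4 ^ Suc (Suc m))"
      unfolding even_coeff_rec by (simp add: field_simps power2_eq_square)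
    also have "\<dots> = ?K * of_real (even_coeff (Suc (Suc m)) (Suc (Suc n)) / 4 ^ Suc (Suc m))"
      by simp
    finally show ?case
      by (subst (asm) mult_left_cancel) (simp_all only: of_nat_eq_0_iff, simp_all)
  qed
qed

section \<open>Expansions inside the unit disc\<close>

lemma arcsin_pow_fps_sums:
  assumes "norm z < 1"
  shows "(\<lambda>n. fps_nth (arcsin_pow_fps k) n * z ^ n) sums (Arcsin z ^ k / fact k)"
proof (rule has_fps_expansion_imp_sums_complex[where r = 1])
  have "(\<lambda>z. (1 / fact k) * Arcsin z ^ k) has_fps_expansion arcsin_pow_fps k"
    unfolding arcsin_pow_fps_def by (intro fps_expansion_intros has_fps_expansion_Arcsin)
  then show "(\<lambda>z. Arcsin z ^ k / fact k) has_fps_expansion arcsin_pow_fps k"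
    by simp
  show "(\<lambda>z. Arcsin z ^ k / fact k) holomorphic_on eball 0 1"
    using holomorphic_on_Arcsin_ball by (auto intro!: holomorphic_intros simp: one_ereal_def)
  show "ereal (norm z) < 1"
    using assms by simp
qed

text \<open>By parity the Taylor series is supported on odd indices, so it can be reindexed without
  changing its sum.\<close>

lemma odd_coeff_sums:
  assumes "norm z < 1"
  shows "(\<lambda>n. of_real (odd_coeff m n) * z ^ (2 * n + 1)) sums (Arcsin z ^ (2 * m + 1) / fact (2 * m + 1))"
proof -
  let ?f = "\<lambda>n. fps_nth (arcsin_pow_fps (2 * m + 1)) n * z ^ n"
  have "strict_mono (\<lambda>n::nat. 2 * n + 1)"
    by (simp add: strict_mono_def)
  moreover have "?f n = 0" if "n \<notin> range (\<lambda>n. 2 * n + 1)" for n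
  proof -
    have "even n"
      by (rule ccontr) (use that in \<open>auto elim!: oddE\<close>)
    then show ?thesis
      using arcsin_pow_fps_parity[of "2 * m + 1" n] by simp
  qed
  ultimately have "(\<lambda>n. ?f (2 * n + 1)) sums (Arcsin z ^ (2 * m + 1) / fact (2 * m + 1))"
    using arcsin_pow_fps_sums[OF assms] by (subst sums_mono_reindex)
  then show ?thesis
    by (simp only: arcsin_pow_fps_odd)
qed

text \<open>Only positive even indices survive: odd ones by parity, index 0 because arcsin vanishes
  at 0.\<close>

lemma even_coeff_sums:
  assumes "norm z < 1"
  shows "(\<lambda>n. of_real (even_coeff (Suc m) (Suc n)) * z ^ (2 * Suc n)) sums
    (2 ^ (2 * Suc m) * Arcsin z ^ (2 * Suc m) / fact (2 * Suc m))"
proof -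
  let ?f = "\<lambda>n. fps_nth (arcsin_pow_fps (2 * Suc m)) n * z ^ n"
  have "strict_mono (\<lambda>n::nat. 2 * Suc n)"
    by (simp add: strict_mono_def)
  moreover have "?f n = 0" if "n \<notin> range (\<lambda>n. 2 * Suc n)" for n
  proof (cases "odd n")
    case True
    then show ?thesis
      using arcsin_pow_fps_parity[of "2 * Suc m" n] by simp
  next
    case False
    then obtain j where j: "n = 2 * j" by blast
    with that have "j = 0"
      by (cases j) auto
    then show ?thesis
      using arcsin_pow_fps_nth_0[of "2 * Suc m"] j by simp
  qed
  ultimately have "(\<lambda>n. ?f (2 * Suc n)) sums (Arcsin z ^ (2 * Suc m) / fact (2 * Suc m))"
    using arcsin_pow_fps_sums[OF assms] by (subst sums_mono_reindex)
  then have "(\<lambda>n. 4 ^ Suc m * ?f (2 * Suc n)) sums (4 ^ Suc m * (Arcsin z ^ (2 * Suc m) / fact (2 * Suc m)))"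
    by (rule sums_mult)
  moreover have "4 ^ Suc m * ?f (2 * Suc n) = of_real (even_coeff (Suc m) (Suc n)) * z ^ (2 * Suc n)" for n
    unfolding arcsin_pow_fps_even by simp
  moreover have "(2::complex) ^ (2 * Suc m) = 4 ^ Suc m"
    unfolding power_mult by simp
  ultimately show ?thesis
    by (simp only: times_divide_eq_right)
qed

section \<open>Extension to the unit circle\<close>

text \<open>
  Bounded partial sums near \<open>1\<close> make \<open>a\<close> summable, so \<open>a\<close> itself is the dominating
  sequence in Tannery's theorem along the radius to \<open>w\<close>.
\<close>

lemma nonneg_power_series_sums_boundary:
  fixes a :: "nat \<Rightarrow> real" and f :: "complex \<Rightarrow> complex"
  assumes nonneg: "\<And>n. 0 \<le> a n"
    and sums: "\<And>z. norm z < 1 \<Longrightarrow> (\<lambda>n. of_real (a n) * z ^ e n) sums f z"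
    and bound: "\<And>x. 0 < x \<Longrightarrow> x < 1 \<Longrightarrow> norm (f (of_real x)) \<le> B"
    and w: "norm w = 1"
    and lim: "((\<lambda>r. f (of_real r * w)) \<longlongrightarrow> f w) (at_left 1)"
  shows "(\<lambda>n. of_real (a n) * w ^ e n) sums f w"
proof -
  have interval: "eventually (\<lambda>r::real. r \<in> {0<..<1}) (at_left 1)"
    by (rule eventually_at_left_real) simp
  have "summable a"
  proof (rule summableI_nonneg_bounded)
    show "0 \<le> a n" for n by (rule nonneg)
    show "(\<Sum>n<N. a n) \<le> B" for N
    proof (rule tendsto_upperbound)
      have "((\<lambda>r. \<Sum>n<N. a n * r ^ e n) \<longlongrightarrow> (\<Sum>n<N. a n * 1 ^ e n)) (at_left 1)"
        by (intro tendsto_intros)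
      then show "((\<lambda>r. \<Sum>n<N. a n * r ^ e n) \<longlongrightarrow> (\<Sum>n<N. a n)) (at_left 1)"
        by simp
      show "\<forall>\<^sub>F r in at_left 1. (\<Sum>n<N. a n * r ^ e n) \<le> B"
      proof (rule eventually_mono[OF interval])
        fix r :: real assume r: "r \<in> {0<..<1}"
        then have "(\<lambda>n. of_real (a n) * of_real r ^ e n) sums f (of_real r)"
          by (intro sums) simp
        \<comment> \<open>At real \<open>r\<close> all terms are real and nonnegative, so a partial
          sum is at most the full sum, which the bound on \<open>f\<close> controls.\<close>
        then have s: "(\<lambda>n. a n * r ^ e n) sums Re (f (of_real r))"
          using sums_Re by fastforce
        have "(\<Sum>n<N. a n * r ^ e n) \<le> (\<Sum>n. a n * r ^ e n)"
          using s r nonneg by (intro sum_le_suminf) (auto simp: sums_iff)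
        also have "\<dots> \<le> norm (f (of_real r))"
          using s complex_Re_le_cmod by (simp add: sums_iff)
        also have "\<dots> \<le> B"
          using r by (intro bound) auto
        finally show "(\<Sum>n<N. a n * r ^ e n) \<le> B" .
      qed
    qed simp
  qed
  have "eventually (\<lambda>r. summable (\<lambda>k. norm (of_real (a k) * (of_real r * w) ^ e k))) (at_left 1) \<and>
    summable (\<lambda>k. norm (of_real (a k) * w ^ e k)) \<and>
    ((\<lambda>r. \<Sum>k. of_real (a k) * (of_real r * w) ^ e k) \<longlongrightarrow> (\<Sum>k. of_real (a k) * w ^ e k)) (at_left 1)"
  proof (rule tannerys_theorem[where M = a])
    show "((\<lambda>r. of_real (a k) * (of_real r * w) ^ e k) \<longlongrightarrow> of_real (a k) * w ^ e k) (at_left 1)" for k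
    proof -
      have "((\<lambda>r. of_real (a k) * (of_real r * w) ^ e k) \<longlongrightarrow> of_real (a k) * (of_real 1 * w) ^ e k) (at_left 1)"
        by (intro tendsto_intros)
      then show ?thesis by simp
    qed
    \<comment> \<open>The domination holds for every index \<open>k\<close>; only \<open>r\<close>
      has to be restricted.\<close>
    have "eventually (\<lambda>x. True \<and> snd x \<in> {0<..<1::real}) (sequentially \<times>\<^sub>F at_left 1)"
      by (rule eventually_prodI[OF always_eventually interval]) simp
    then show "\<forall>\<^sub>F (k, r) in sequentially \<times>\<^sub>F at_left 1. norm (of_real (a k) * (of_real r * w) ^ e k) \<le> a k"
    proof (rule eventually_mono)
      fix x :: "nat \<times> real" assume x: "True \<and> snd x \<in> {0<..<1}"
      obtain k r where kr: "x = (k, r)" by (cases x)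
      have "r ^ e k \<le> 1"
        using x kr by (intro power_le_one) auto
      then have "norm (of_real (a k) * (of_real r * w) ^ e k) \<le> a k"
        using x kr nonneg[of k] w
        by (simp add: norm_mult norm_power mult_left_le)
      then show "case x of (k, r) \<Rightarrow> norm (of_real (a k) * (of_real r * w) ^ e k) \<le> a k"
        using kr by simp
    qed
  qed (use \<open>summable a\<close> in auto)
  then have summ: "summable (\<lambda>k. of_real (a k) * w ^ e k)"
    and lim': "((\<lambda>r. \<Sum>k. of_real (a k) * (of_real r * w) ^ e k) \<longlongrightarrow> (\<Sum>k. of_real (a k) * w ^ e k)) (at_left 1)"
    by (auto intro: summable_norm_cancel)
  have "eventually (\<lambda>r. (\<Sum>k. of_real (a k) * (of_real r * w) ^ e k) = f (of_real r * w)) (at_left 1)"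
    using interval
  proof (rule eventually_mono)
    fix r :: real assume "r \<in> {0<..<1}"
    then show "(\<Sum>k. of_real (a k) * (of_real r * w) ^ e k) = f (of_real r * w)"
      using sums[of "of_real r * w"] w by (simp add: norm_mult sums_iff)
  qed
  then have "((\<lambda>r. f (of_real r * w)) \<longlongrightarrow> (\<Sum>k. of_real (a k) * w ^ e k)) (at_left 1)"
    using lim' by (rule Lim_transform_eventually[rotated])
  \<comment> \<open>Both the boundary series and \<open>f w\<close> are limits of the same function
    along the radius.\<close>
  then have "(\<Sum>k. of_real (a k) * w ^ e k) = f w"
    using lim by (rule tendsto_unique[rotated]) simp
  then show ?thesis
    using summ by (simp add: sums_iff)
qed

text \<open>At \<open>w = 1\<close>, an end of the branch cut, only continuity along the real axis is available.\<close>

lemma Arcsin_radial_limit: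
  assumes "norm w = 1" "0 \<le> Re w"
  shows "((\<lambda>r. Arcsin (of_real r * w)) \<longlongrightarrow> Arcsin w) (at_left 1)"
proof -
  have lim: "((\<lambda>r. of_real r * w) \<longlongrightarrow> of_real 1 * w) (at_left (1::real))"
    by (intro tendsto_intros)
  show ?thesis
  proof (cases "Im w = 0")
    case False
    then have "isCont Arcsin w"
      by (intro isCont_Arcsin) simp
    then show ?thesis
      using isCont_tendsto_compose lim by fastforce
  next
    case True
    \<comment> \<open>A real point of the unit circle is 1 or -1, and \<open>0 \<le> Re w\<close>
      excludes -1.\<close>
    then have [simp]: "w = 1"
      using assms by (auto simp: complex_eq_iff norm_complex_def)
    have "filterlim (\<lambda>r. of_real r * w) (at w within {w \<in> \<real>. \<bar>Re w\<bar> \<le> 1}) (at_left (1::real))"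
      unfolding filterlim_at
      using lim eventually_at_left_real[of 0 1] by (auto elim!: eventually_mono)
    moreover have "(Arcsin \<longlongrightarrow> Arcsin w) (at w within {w \<in> \<real>. \<bar>Re w\<bar> \<le> 1})"
      by (rule continuous_within_Arcsin_real[unfolded continuous_within])
    ultimately show ?thesis
      by (rule filterlim_compose[rotated])
  qed
qed

lemma norm_Arcsin_of_real_le:
  assumes "0 < x" "x < 1"
  shows "norm (Arcsin (of_real x)) \<le> pi / 2"
  using assms arcsin_bounded[of x] by (simp flip: of_real_arcsin) linarith

lemma odd_coeff_sums_boundary:
  assumes "norm w = 1" "0 \<le> Re w"
  shows "(\<lambda>n. of_real (odd_coeff m n) * w ^ (2 * n + 1)) sums (Arcsin w ^ (2 * m + 1) / fact (2 * m + 1))"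
proof (rule nonneg_power_series_sums_boundary[where f = "\<lambda>z. Arcsin z ^ (2 * m + 1) / fact (2 * m + 1)"
      \<comment> \<open>The bound comes from real arcsin taking values in [-pi/2, pi/2].\<close>
      and B = "(pi / 2) ^ (2 * m + 1) / fact (2 * m + 1)"])
  show "norm (Arcsin (of_real x) ^ (2 * m + 1) / fact (2 * m + 1)) \<le> (pi / 2) ^ (2 * m + 1) / fact (2 * m + 1)"
    if "0 < x" "x < 1" for x
    using norm_Arcsin_of_real_le[OF that]
    by (simp add: norm_divide norm_power del: fact_Suc power_Suc) (intro divide_right_mono power_mono, auto)
  show "((\<lambda>r. Arcsin (of_real r * w) ^ (2 * m + 1) / fact (2 * m + 1)) \<longlongrightarrow>
      Arcsin w ^ (2 * m + 1) / fact (2 * m + 1)) (at_left 1)"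
    by (intro tendsto_intros Arcsin_radial_limit assms) (rule fact_nonzero)
  show "0 \<le> odd_coeff m n" for n
    by (simp add: odd_coeff_def t2_nonneg)
qed (use odd_coeff_sums assms in auto)

lemma even_coeff_sums_boundary:
  assumes "norm w = 1" "0 \<le> Re w"
  shows "(\<lambda>n. of_real (even_coeff (Suc m) (Suc n)) * w ^ (2 * Suc n)) sums
    (2 ^ (2 * Suc m) * Arcsin w ^ (2 * Suc m) / fact (2 * Suc m))"
proof (rule nonneg_power_series_sums_boundary[where f = "\<lambda>z. 2 ^ (2 * Suc m) * Arcsin z ^ (2 * Suc m) / fact (2 * Suc m)"
      and B = "2 ^ (2 * Suc m) * (pi / 2) ^ (2 * Suc m) / fact (2 * Suc m)"])
  show "norm (2 ^ (2 * Suc m) * Arcsin (of_real x) ^ (2 * Suc m) / fact (2 * Suc m)) \<le>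
      2 ^ (2 * Suc m) * (pi / 2) ^ (2 * Suc m) / fact (2 * Suc m)"
    if "0 < x" "x < 1" for x
    unfolding norm_divide norm_mult norm_power norm_fact norm_numeral
    using norm_Arcsin_of_real_le[OF that]
    by (intro divide_right_mono mult_left_mono power_mono) auto
  show "((\<lambda>r. 2 ^ (2 * Suc m) * Arcsin (of_real r * w) ^ (2 * Suc m) / fact (2 * Suc m)) \<longlongrightarrow>
      2 ^ (2 * Suc m) * Arcsin w ^ (2 * Suc m) / fact (2 * Suc m)) (at_left 1)"
    by (intro tendsto_intros Arcsin_radial_limit assms) (rule fact_nonzero)
  show "0 \<le> even_coeff (Suc m) (Suc n)" for n
    by (simp add: even_coeff_def zeta2_nonneg)
qed (use even_coeff_sums assms in auto)

section \<open>Roots of unity and finite Fourier inversion\<close>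

lemma root_unity_nonzero: "root_unity q \<noteq> 0"
  by (simp add: root_unity_def)

lemma norm_root_unity: "norm (root_unity q) = 1"
  by (simp add: root_unity_def norm_exp_eq_Re)

lemma root_unity_power: "root_unity q ^ n = exp (2 * of_real pi * \<i> * of_nat n / of_nat q)"
  by (simp add: root_unity_def mult_ac flip: exp_of_nat_mult)

lemma eta_eq_cis: "eta q l = cis (Arg (root_unity q ^ l) / 2)"
  by (simp add: eta_def cis_conv_exp)

lemma norm_eta: "norm (eta q l) = 1"
  by (simp add: eta_eq_cis)

text \<open>Half of a principal argument lies in (-pi/2, pi/2], where cosine is nonnegative.\<close>

lemma Re_eta_nonneg: "0 \<le> Re (eta q l)"
  using Arg_bounded[of "root_unity q ^ l"] by (auto simp: eta_eq_cis intro!: cos_ge_zero)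

lemma eta_square: "eta q l ^ 2 = root_unity q ^ l"
proof -
  have "eta q l ^ 2 = cis (Arg (root_unity q ^ l))"
    by (simp add: eta_eq_cis power2_eq_square cis_mult)
  then show ?thesis
    by (simp add: cis_Arg root_unity_nonzero sgn_div_norm norm_power norm_root_unity)
qed

text \<open>Orthogonality of characters: after exchanging the sums, only the residue
  \<open>n mod q\<close> survives, and periodicity identifies its value with that at
  \<open>n\<close>.\<close>

lemma psi_hat_inversion:
  assumes "q \<ge> 1" and per: "\<And>n. \<psi> (n + int q) = \<psi> n"
  shows "(\<Sum>l<q. psi_hat q \<psi> l * root_unity q ^ (l * n)) = \<psi> (int n)"
proof -
  let ?w = "root_unity q"
  have mult_per: "\<psi> (x + int k * int q) = \<psi> x" for x k
  proof (induction k)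
    case (Suc k)
    then show ?case
      using per[of "x + int k * int q"] by (simp add: algebra_simps)
  qed simp
  have "\<psi> (int n) = \<psi> (int (n mod q))"
    using mult_per[of "int (n mod q)" "n div q"] by (simp flip: of_nat_mult of_nat_add)
  have root: "?w ^ (k * q) = 1" for k
    unfolding root_unity_power using complex_root_unity[of q k] root_unity_power[of q k] assms(1)
    by (metis not_one_le_zero power_mult root_unity_power)
  have inner: "(\<Sum>l<q. ?w powi (- (int r * int l)) * ?w ^ (l * n)) = (if r = n mod q then of_nat q else 0)"
    if "r < q" for r
  proof -
    \<comment> \<open>This is a \<open>q\<close>-th root of unity, so its geometric sum is
      \<open>q\<close> if it equals 1 and 0 otherwise.\<close>
    let ?x = "?w ^ n / ?w ^ r"
    have x: "?w powi (- (int r * int l)) * ?w ^ (l * n) = ?x ^ l" for l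
      by (simp add: power_int_minus power_divide field_simps flip: of_nat_mult power_mult)
    have "?x = 1 \<longleftrightarrow> n mod q = r mod q"
      using complex_root_unity_eq[OF assms(1), of n r] root_unity_nonzero[of q]
      by (simp add: root_unity_power)
    moreover have "?x ^ q = 1"
      by (simp add: power_divide root flip: power_mult)
    ultimately show ?thesis
      using that unfolding x by (auto simp: geometric_sum)
  qed
  have "(\<Sum>l<q. psi_hat q \<psi> l * ?w ^ (l * n)) =
      (\<Sum>l<q. \<Sum>r<q. 1 / of_nat q * \<psi> (int r) * (?w powi (- (int r * int l)) * ?w ^ (l * n)))"
    unfolding psi_hat_def by (simp only: sum_distrib_left sum_distrib_right mult.assoc)
  also have "\<dots> = (\<Sum>r<q. 1 / of_nat q * \<psi> (int r) * (\<Sum>l<q. ?w powi (- (int r * int l)) * ?w ^ (l * n)))"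
    by (subst sum.swap) (simp only: sum_distrib_left)
  also have "\<dots> = (\<Sum>r<q. if r = n mod q then \<psi> (int r) else 0)"
    using assms(1) by (intro sum.cong) (simp_all add: inner)
  also have "\<dots> = \<psi> (int (n mod q))"
    using assms(1) by simp
  finally show ?thesis
    using \<open>\<psi> (int n) = \<psi> (int (n mod q))\<close> by simp
qed

text \<open>A finite combination of convergent series may be summed termwise. The exponent map
  \<open>g\<close> accommodates summation from 0 and from 1.\<close>

lemma psi_hat_combination_sums:
  fixes c :: "nat \<Rightarrow> complex"
  assumes "q \<ge> 1" and "\<And>n. \<psi> (n + int q) = \<psi> n"
    and "\<And>l. (\<lambda>n. c n * (eta q l ^ 2) ^ g n) sums s l"
  shows "(\<lambda>n. \<psi> (int (g n)) * c n) sums (\<Sum>l<q. psi_hat q \<psi> l * s l)"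
proof -
  have "(\<lambda>n. \<Sum>l<q. psi_hat q \<psi> l * (c n * (eta q l ^ 2) ^ g n)) sums (\<Sum>l<q. psi_hat q \<psi> l * s l)"
    by (intro sums_sum sums_mult assms)
  moreover have "(\<Sum>l<q. psi_hat q \<psi> l * (c n * (eta q l ^ 2) ^ g n)) = \<psi> (int (g n)) * c n" for n
    unfolding psi_hat_inversion[where \<psi> = \<psi>, OF assms(1,2), symmetric] sum_distrib_right eta_square
    by (simp add: mult_ac flip: power_mult)
  ultimately show ?thesis by simp
qed

section \<open>Inserting the boundary expansions into the Fourier combination\<close>

theorem theorem5p2:
  fixes q :: nat and \<psi> :: "int \<Rightarrow> complex"
  assumes "q \<ge> 1"
    and "\<And>n. \<psi> (n + int q) = \<psi> n"
  shows "(\<forall>m. (\<lambda>n. \<psi> (int n) * of_real (real ((2 * n) choose n) / (4 ^ n * (2 * real n + 1)) * t2 n m))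
            sums (\<Sum>l<q. psi_hat q \<psi> l * (Arcsin (eta q l) ^ (2 * m + 1) / (fact (2 * m + 1) * eta q l))))
    \<and> (\<forall>m\<ge>1. (\<lambda>k. let n = k + 1 in
              \<psi> (int n) * of_real (4 ^ n / ((real n)\<^sup>2 * real ((2 * n) choose n)) * zeta2 (n - 1) (m - 1)))
            sums (\<Sum>l<q. psi_hat q \<psi> l * (2 ^ (2 * m) * Arcsin (eta q l) ^ (2 * m) / fact (2 * m))))"
proof (intro conjI allI impI)
  fix m
  have "(\<lambda>n. of_real (odd_coeff m n) * (eta q l ^ 2) ^ n) sums
      (Arcsin (eta q l) ^ (2 * m + 1) / (fact (2 * m + 1) * eta q l))" for l
  proof -
    have "eta q l \<noteq> 0"
      using norm_eta[of q l] by auto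
    then show ?thesis
      \<comment> \<open>Dividing by \<open>eta q l\<close> lowers the exponent 2n + 1 to 2n, leaving
        a power of \<open>eta q l ^ 2\<close>; this is the source of the denominator in the closed
        form.\<close>
      using sums_divide[OF odd_coeff_sums_boundary[OF norm_eta Re_eta_nonneg, of m q l], of "eta q l"]
      by (simp add: power_mult del: fact_Suc)
  qed
  from psi_hat_combination_sums[where \<psi> = \<psi> and g = "\<lambda>n. n", OF assms this]
  show "(\<lambda>n. \<psi> (int n) * of_real (real ((2 * n) choose n) / (4 ^ n * (2 * real n + 1)) * t2 n m))
      sums (\<Sum>l<q. psi_hat q \<psi> l * (Arcsin (eta q l) ^ (2 * m + 1) / (fact (2 * m + 1) * eta q l)))"
    unfolding odd_coeff_def .
next
  fix m :: nat assume "m \<ge> 1"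
  then obtain j where m: "m = Suc j"
    by (cases m) auto
  have "(\<lambda>n. of_real (even_coeff (Suc j) (Suc n)) * (eta q l ^ 2) ^ Suc n) sums
      (2 ^ (2 * Suc j) * Arcsin (eta q l) ^ (2 * Suc j) / fact (2 * Suc j))" for l
    using even_coeff_sums_boundary[OF norm_eta Re_eta_nonneg, of j q l] unfolding power_mult[of "eta q l"] .
  from psi_hat_combination_sums[where \<psi> = \<psi> and g = Suc, OF assms this]
  show "(\<lambda>k. let n = k + 1 in
        \<psi> (int n) * of_real (4 ^ n / ((real n)\<^sup>2 * real ((2 * n) choose n)) * zeta2 (n - 1) (m - 1)))
      sums (\<Sum>l<q. psi_hat q \<psi> l * (2 ^ (2 * m) * Arcsin (eta q l) ^ (2 * m) / fact (2 * m)))"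
    unfolding m even_coeff_def Let_def Suc_eq_plus1[symmetric] .
qed

end
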